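(* Let $R$ be a Dedekind domain with field of fractions $K$, $n\ge1$, and $\underline{S}\subseteq R^n$ with $I(\underline{S})=\{0\}$. Let $f\in R[\underline{x}]$ be a polynomial of type $(\mathbf{m},k)$. Then for each $\underline{a}\in\underline{S}$ such that $f(\underline{a})\ne0$ there exists an element $\underline{b}\in R^n$ such that $d(\underline{S},f)=(f(\underline{a}),f(\underline{b}))$.
   Context: $\underline{x}=(x_1,\dots,x_n)$. $f$ is of type $(\mathbf{m},k)$ if its $n$-tuple of partial degrees is $\mathbf{m}$ and its total degree is $k$. $I(\underline{S})=\{g\in K[\underline{x}]:g(\underline{S})=0\}$. The fixed divisor $d(\underline{S},f)$ is the ideal of $R$ generated by $\{f(\underline{s}):\underline{s}\in\underline{S}\}$; $(c,c')$ denotes the ideal generated by $c$ and $c'$. *)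

theory Defs
  imports
    "HOL-Analysis.Finite_Cartesian_Product"
    "HOL-Library.Poly_Mapping"
    "HOL-Computational_Algebra.Polynomial_Factorial"
begin

section \<open>Ideals and Dedekind domains\<close>

text \<open>The ideals of a commutative ring are its submodules when it is viewed as a module over
  itself, so the submodule notions of \<^locale>\<open>module\<close> are used with multiplication as scaling.\<close>

lemma module_times: "module ((*) :: 'a::comm_ring_1 \<Rightarrow> 'a \<Rightarrow> 'a)"
  by standard (auto simp: algebra_simps)

definition is_ideal :: "'a::comm_ring_1 set \<Rightarrow> bool" where
  "is_ideal I \<longleftrightarrow> module.subspace (*) I"

definition ideal_generated :: "'a::comm_ring_1 set \<Rightarrow> 'a set" where
  "ideal_generated X = module.span (*) X"

definition prime_ideal :: "'a::comm_ring_1 set \<Rightarrow> bool" where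
  "prime_ideal P \<longleftrightarrow> is_ideal P \<and> P \<noteq> UNIV \<and> (\<forall>x y. x * y \<in> P \<longrightarrow> x \<in> P \<or> y \<in> P)"

definition maximal_ideal :: "'a::comm_ring_1 set \<Rightarrow> bool" where
  "maximal_ideal M \<longleftrightarrow>
     is_ideal M \<and> M \<noteq> UNIV \<and> (\<forall>J. is_ideal J \<and> M \<subseteq> J \<longrightarrow> J = M \<or> J = UNIV)"

definition noetherian :: "'a::comm_ring_1 itself \<Rightarrow> bool" where
  "noetherian _ \<longleftrightarrow> (\<forall>I::'a set. is_ideal I \<longrightarrow> (\<exists>X. finite X \<and> I = ideal_generated X))"

definition integral_over_base :: "'a::idom fract \<Rightarrow> bool" where
  "integral_over_base x \<longleftrightarrow>
     (\<exists>p::'a poly. lead_coeff p = 1 \<and> poly (map_poly to_fract p) x = 0)"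

definition integrally_closed :: "'a::idom itself \<Rightarrow> bool" where
  "integrally_closed _ \<longleftrightarrow> (\<forall>x::'a fract. integral_over_base x \<longrightarrow> x \<in> range to_fract)"

text \<open>Fields are not excluded: they satisfy all three conditions.\<close>

definition dedekind_domain :: "'a::idom itself \<Rightarrow> bool" where
  "dedekind_domain _ \<longleftrightarrow>
     noetherian TYPE('a) \<and> integrally_closed TYPE('a) \<and>
     (\<forall>P::'a set. prime_ideal P \<and> P \<noteq> {0} \<longrightarrow> maximal_ideal P)"

section \<open>Polynomials in variables indexed by a finite type\<close>

text \<open>A polynomial is the finitely supported map sending an exponent vector to its coefficient;
  addition and multiplication (convolution) are those of the type of finitely supported maps.\<close>

type_synonym ('n, 'a) mpol = "('n \<Rightarrow>\<^sub>0 nat) \<Rightarrow>\<^sub>0 'a"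

definition mpol_eval :: "('n::finite, 'a::comm_ring_1) mpol \<Rightarrow> 'a ^ 'n \<Rightarrow> 'a" where
  "mpol_eval f x =
     (\<Sum>e\<in>Poly_Mapping.keys f.
        Poly_Mapping.lookup f e * (\<Prod>i\<in>UNIV. (x $ i) ^ Poly_Mapping.lookup e i))"

text \<open>Both degrees of the zero polynomial are 0 by convention.\<close>

definition partial_degree :: "('n::finite, 'a::zero) mpol \<Rightarrow> 'n \<Rightarrow> nat" where
  "partial_degree f i = Max (insert 0 ((\<lambda>e. Poly_Mapping.lookup e i) ` Poly_Mapping.keys f))"

definition total_degree :: "('n::finite, 'a::zero) mpol \<Rightarrow> nat" where
  "total_degree f =
     Max (insert 0 ((\<lambda>e. \<Sum>i\<in>UNIV. Poly_Mapping.lookup e i) ` Poly_Mapping.keys f))"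

definition has_type :: "('n::finite, 'a::zero) mpol \<Rightarrow> nat ^ 'n \<Rightarrow> nat \<Rightarrow> bool" where
  "has_type f m k \<longleftrightarrow> (\<forall>i. partial_degree f i = m $ i) \<and> total_degree f = k"

section \<open>Vanishing ideal and fixed divisor\<close>

text \<open>The vanishing ideal lives over the field of fractions, so points are embedded first.\<close>

definition vanishing_ideal :: "('a::idom ^ 'n::finite) set \<Rightarrow> ('n, 'a fract) mpol set" where
  "vanishing_ideal S = {g. \<forall>s\<in>S. mpol_eval g (\<chi> i. to_fract (s $ i)) = 0}"

definition fixed_divisor ::
    "('a::comm_ring_1 ^ 'n::finite) set \<Rightarrow> ('n, 'a) mpol \<Rightarrow> 'a set" where
  "fixed_divisor S f = ideal_generated (mpol_eval f ` S)"

end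

theory Submission
  imports Defs
begin

text \<open>
  Let \<open>D\<close> be the fixed divisor and \<open>c = f(a)\<close>. Nonzero ideals of \<open>R\<close> factor into maximal ideals, so only
  finitely many maximal ideals \<open>P\<close> contain \<open>c\<close>, and \<open>D\<close> is the product of the powers \<open>P ^ d P\<close> of
  these. As \<open>P * D \<noteq> D\<close>, each \<open>P\<close> admits a point \<open>s P\<close> of \<open>S\<close> with \<open>f(s P) \<notin> P * D\<close>. By the Chinese
  remainder theorem there is \<open>b\<close> with \<open>b \<equiv> s P\<close> modulo \<open>P ^ (d P + 1)\<close> for all \<open>P\<close>; then \<open>f(b) \<in> D\<close>, and
  \<open>f(b) \<notin> P * D\<close> for all \<open>P\<close>. Since \<open>(c, f(b)) \<subseteq> D\<close>, we have \<open>(c, f(b)) = D * E\<close> for an ideal \<open>E\<close>, and no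
  maximal ideal contains \<open>E\<close>.
\<close>

section \<open>The semiring of ideals\<close>

text \<open>Once ideals form a type, class instances supply powers, finite products and
  \<open>prod_mset\<close> of ideals, together with their algebraic laws.\<close>

typedef (overloaded) 'a ideal = "{I :: 'a::comm_ring_1 set. is_ideal I}"
  morphisms elts Ideal
  using module.subspace_UNIV[OF module_times] by (auto simp: is_ideal_def)

lemma is_ideal_elts [simp]: "is_ideal (elts A)"
  using elts by auto

lemma elts_Ideal: "is_ideal I \<Longrightarrow> elts (Ideal I) = I"
  by (rule Ideal_inverse) simp

lemma
  shows zero_in_elts [simp]: "0 \<in> elts A"
    and add_in_elts: "x \<in> elts A \<Longrightarrow> y \<in> elts A \<Longrightarrow> x + y \<in> elts A"
    and mult_in_elts: "x \<in> elts A \<Longrightarrow> c * x \<in> elts A"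
    and mult_in_elts': "x \<in> elts A \<Longrightarrow> x * c \<in> elts A"
    and diff_in_elts: "x \<in> elts A \<Longrightarrow> y \<in> elts A \<Longrightarrow> x - y \<in> elts A"
    and sum_in_elts: "(\<And>i. i \<in> J \<Longrightarrow> g i \<in> elts A) \<Longrightarrow> sum g J \<in> elts A"
proof -
  note sub = is_ideal_elts[of A, unfolded is_ideal_def]
  note rules = module.subspace_0[OF module_times] module.subspace_add[OF module_times]
    module.subspace_scale[OF module_times] module.subspace_diff[OF module_times]
    module.subspace_sum[OF module_times]
  show "0 \<in> elts A" "x \<in> elts A \<Longrightarrow> y \<in> elts A \<Longrightarrow> x + y \<in> elts A"
    "x \<in> elts A \<Longrightarrow> c * x \<in> elts A" "x \<in> elts A \<Longrightarrow> y \<in> elts A \<Longrightarrow> x - y \<in> elts A"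
    "(\<And>i. i \<in> J \<Longrightarrow> g i \<in> elts A) \<Longrightarrow> sum g J \<in> elts A"
    by (fact rules[OF sub])+
  then show "x \<in> elts A \<Longrightarrow> x * c \<in> elts A"
    by (simp add: mult.commute)
qed

lemma is_idealI:
  assumes "0 \<in> I" "\<And>x y. x \<in> I \<Longrightarrow> y \<in> I \<Longrightarrow> x + y \<in> I" "\<And>c x. x \<in> I \<Longrightarrow> c * x \<in> I"
  shows "is_ideal I"
  unfolding is_ideal_def using assms by (intro module.subspaceI[OF module_times]) auto

definition gen :: "'a::comm_ring_1 set \<Rightarrow> 'a ideal" where
  "gen X = Ideal (ideal_generated X)"

lemma elts_gen: "elts (gen X) = ideal_generated X"
  unfolding gen_def
  by (rule elts_Ideal) (simp add: is_ideal_def ideal_generated_def module.subspace_span[OF module_times])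

section \<open>Inclusion, sum and product of ideals\<close>

instantiation ideal :: (comm_ring_1) order
begin

definition less_eq_ideal :: "'a ideal \<Rightarrow> 'a ideal \<Rightarrow> bool" where
  "A \<le> B \<longleftrightarrow> elts A \<subseteq> elts B"

definition less_ideal :: "'a ideal \<Rightarrow> 'a ideal \<Rightarrow> bool" where
  "(A :: 'a ideal) < B \<longleftrightarrow> A \<le> B \<and> \<not> B \<le> A"

instance
  by standard (auto simp: less_eq_ideal_def less_ideal_def elts_inject)

end

lemma elts_mono: "A \<le> B \<Longrightarrow> x \<in> elts A \<Longrightarrow> x \<in> elts B"
  by (auto simp: less_eq_ideal_def)

text \<open>Generated ideals, sums and products are least ideals with some property, so the ideals
  above them are known explicitly; this reduces semiring laws to membership statements.\<close>

lemma ideal_eqI: "(\<And>C. A \<le> C \<longleftrightarrow> B \<le> C) \<Longrightarrow> A = (B :: 'a::comm_ring_1 ideal)"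
  by (meson order.antisym order.refl)

lemma gen_le_iff [simp]: "gen X \<le> A \<longleftrightarrow> X \<subseteq> elts A"
proof
  show "gen X \<le> A \<Longrightarrow> X \<subseteq> elts A"
    using module.span_superset[OF module_times]
    by (auto simp: less_eq_ideal_def elts_gen ideal_generated_def)
  show "X \<subseteq> elts A \<Longrightarrow> gen X \<le> A"
    using module.span_minimal[OF module_times] is_ideal_elts[of A]
    by (auto simp: less_eq_ideal_def elts_gen ideal_generated_def is_ideal_def)
qed

lemma gen_base: "x \<in> X \<Longrightarrow> x \<in> elts (gen X)"
  using gen_le_iff[of X "gen X"] by auto

text \<open>The ideal quotient of \<open>A\<close> by \<open>a\<close>. It turns an upper bound on a
  product into upper bounds on one of its factors, and it provides the cofactor when
  \<open>a\<close> divides every element of \<open>A\<close>.\<close>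

definition colon :: "'a::comm_ring_1 \<Rightarrow> 'a ideal \<Rightarrow> 'a ideal" where
  "colon a A = Ideal {x. a * x \<in> elts A}"

lemma in_colon_iff [simp]: "x \<in> elts (colon a A) \<longleftrightarrow> a * x \<in> elts A"
proof -
  have "is_ideal {x. a * x \<in> elts A}"
    by (rule is_idealI)
      (auto simp: distrib_left add_in_elts mult_in_elts mult.left_commute[of a])
  then show ?thesis
    by (simp add: colon_def elts_Ideal)
qed

instantiation ideal :: (comm_ring_1) "{plus, times, zero, one}"
begin

definition plus_ideal :: "'a ideal \<Rightarrow> 'a ideal \<Rightarrow> 'a ideal" where
  "A + B = gen (elts A \<union> elts B)"

definition times_ideal :: "'a ideal \<Rightarrow> 'a ideal \<Rightarrow> 'a ideal" where
  "A * B = gen {a * b | a b. a \<in> elts A \<and> b \<in> elts B}"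

definition zero_ideal :: "'a ideal" where
  "0 = gen {}"

definition one_ideal :: "'a ideal" where
  "1 = gen UNIV"

instance ..

end

lemma ideal_add_le_iff: "A + B \<le> C \<longleftrightarrow> A \<le> C \<and> B \<le> (C :: 'a::comm_ring_1 ideal)"
  unfolding plus_ideal_def gen_le_iff by (simp add: less_eq_ideal_def)

lemma ideal_mult_le_iff: "A * B \<le> C \<longleftrightarrow> (\<forall>a\<in>elts A. \<forall>b\<in>elts B. a * b \<in> elts C)"
  by (auto simp: times_ideal_def)

lemma ideal_mult_le_iff_colon: "A * B \<le> C \<longleftrightarrow> (\<forall>a\<in>elts A. B \<le> colon a C)"
  unfolding ideal_mult_le_iff by (simp add: less_eq_ideal_def subset_iff Ball_def)

lemma ideal_mult_commute: "A * B = B * (A :: 'a::comm_ring_1 ideal)"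
proof (rule ideal_eqI)
  fix C
  have "B * A \<le> C" if "A * B \<le> C" for A B :: "'a ideal"
    unfolding ideal_mult_le_iff
  proof (intro ballI)
    fix b a assume "b \<in> elts B" "a \<in> elts A"
    with that have "a * b \<in> elts C"
      by (simp add: ideal_mult_le_iff)
    then show "b * a \<in> elts C"
      by (simp only: mult.commute[of b])
  qed
  then show "A * B \<le> C \<longleftrightarrow> B * A \<le> C"
    by blast
qed

lemma ideal_mult_le_iff_colon': "A * B \<le> C \<longleftrightarrow> (\<forall>b\<in>elts B. A \<le> colon b C)"
  by (simp add: ideal_mult_commute[of A] ideal_mult_le_iff_colon)

lemma elts_1 [simp]: "elts (1 :: 'a::comm_ring_1 ideal) = UNIV"
  using gen_base[of _ UNIV] by (auto simp: one_ideal_def)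

lemma elts_0 [simp]: "elts (0 :: 'a::comm_ring_1 ideal) = {0}"
  by (simp add: zero_ideal_def elts_gen ideal_generated_def module.span_empty[OF module_times])

lemma ideal_ge_0 [simp]: "0 \<le> (A :: 'a::comm_ring_1 ideal)"
  and ideal_le_1 [simp]: "A \<le> 1"
  by (auto simp: less_eq_ideal_def)

instance ideal :: (comm_ring_1) comm_semiring_1
proof
  fix A B C :: "'a ideal"
  show "A + B + C = A + (B + C)" "A + B = B + A" "0 + A = A"
    by (rule ideal_eqI; auto simp: ideal_add_le_iff)+
  show "A * B = B * A"
    by (rule ideal_mult_commute)
  show "A * B * C = A * (B * C)"
  proof (rule ideal_eqI)
    fix D
    \<comment> \<open>Either bracketing lies below \<open>D\<close> exactly when \<open>D\<close>
      contains all products of three elements.\<close>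
    have "A * B * C \<le> D \<longleftrightarrow> (\<forall>c\<in>elts C. \<forall>a\<in>elts A. \<forall>b\<in>elts B. c * (a * b) \<in> elts D)"
      by (simp add: ideal_mult_le_iff_colon'[of "A * B"] ideal_mult_le_iff[of A B])
    also have "\<dots> \<longleftrightarrow> (\<forall>c\<in>elts C. \<forall>a\<in>elts A. \<forall>b\<in>elts B. a * (b * c) \<in> elts D)"
      by (intro ball_cong refl) (simp add: mult_ac)
    finally have "A * B * C \<le> D \<longleftrightarrow>
        (\<forall>c\<in>elts C. \<forall>a\<in>elts A. \<forall>b\<in>elts B. a * (b * c) \<in> elts D)" .
    moreover have "A * (B * C) \<le> D \<longleftrightarrow> (\<forall>a\<in>elts A. \<forall>b\<in>elts B. \<forall>c\<in>elts C. a * (b * c) \<in> elts D)"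
      by (simp add: ideal_mult_le_iff_colon[of A] ideal_mult_le_iff[of B C])
    ultimately show "A * B * C \<le> D \<longleftrightarrow> A * (B * C) \<le> D"
      by blast
  qed
  show "(A + B) * C = A * C + B * C"
    by (rule ideal_eqI) (auto simp: ideal_mult_le_iff_colon' ideal_add_le_iff)
  show "1 * A = A"
  proof (rule ideal_eqI)
    fix C
    show "1 * A \<le> C \<longleftrightarrow> A \<le> C"
    proof
      assume "1 * A \<le> C"
      then have "1 * x \<in> elts C" if "x \<in> elts A" for x
        using that unfolding ideal_mult_le_iff elts_1 by blast
      then show "A \<le> C"
        by (auto simp: less_eq_ideal_def)
    qed (unfold ideal_mult_le_iff, auto simp: less_eq_ideal_def mult_in_elts)
  qed
  show "0 * A = 0"
    by (rule ideal_eqI) (simp add: ideal_mult_le_iff)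
  then show "A * 0 = 0"
    by (simp add: ideal_mult_commute)
  show "(0 :: 'a ideal) \<noteq> 1"
  proof
    assume "(0 :: 'a ideal) = 1"
    then have "elts (0 :: 'a ideal) = elts (1 :: 'a ideal)"
      by (rule arg_cong)
    then have "(1 :: 'a) \<in> {0}"
      unfolding elts_0 elts_1 by blast
    then show False
      by simp
  qed
qed

instance ideal :: (comm_ring_1) ordered_comm_semiring
proof
  fix A B C :: "'a ideal"
  show "A \<le> B \<Longrightarrow> C + A \<le> C + B"
    using ideal_add_le_iff[of C B "C + B"] ideal_add_le_iff[of C A "C + B"] by force
  show "A \<le> B \<Longrightarrow> C * A \<le> C * B"
    using ideal_mult_le_iff[of C B "C * B"] ideal_mult_le_iff[of C A "C * B"] elts_mono by blast
qed

lemma ideal_mult_mono: "A \<le> B \<Longrightarrow> C \<le> D \<Longrightarrow> A * C \<le> B * (D :: 'a::comm_ring_1 ideal)"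
  by (simp add: mult_mono)

lemma ideal_mult_le_left: "A * B \<le> (A :: 'a::comm_ring_1 ideal)"
  using ideal_mult_mono[of A A B 1] by simp

lemma ideal_add_absorb: "A \<le> B \<Longrightarrow> A + B = (B :: 'a::comm_ring_1 ideal)"
  by (rule ideal_eqI) (auto simp: ideal_add_le_iff)

lemma ideal_le_add [simp]: "A \<le> A + (B :: 'a::comm_ring_1 ideal)" "B \<le> A + B"
  using ideal_add_le_iff[of A B "A + B"] by auto

lemma ideal_eq_1_iff: "A = (1 :: 'a::comm_ring_1 ideal) \<longleftrightarrow> 1 \<in> elts A"
proof
  assume "1 \<in> elts A"
  then have "1 \<le> A"
    using mult_in_elts[of 1 A] by (auto simp: less_eq_ideal_def)
  then show "A = 1"
    by (simp add: order.antisym)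
qed simp

lemma elts_mult: "a \<in> elts A \<Longrightarrow> b \<in> elts B \<Longrightarrow> a * b \<in> elts (A * B)"
  using ideal_mult_le_iff[of A B "A * B"] by auto

lemma elts_add:
  fixes A B :: "'a::comm_ring_1 ideal"
  shows "x \<in> elts (A + B) \<longleftrightarrow> (\<exists>a\<in>elts A. \<exists>b\<in>elts B. x = a + b)"
proof -
  have "module.span (*) (elts C) = elts C" for C :: "'a ideal"
    using module.span_eq_iff[OF module_times, of "elts C"] is_ideal_elts[of C]
    by (simp add: is_ideal_def)
  then show ?thesis
    using module.span_Un[OF module_times, of "elts A" "elts B"]
    by (auto simp: plus_ideal_def elts_gen ideal_generated_def)
qed

section \<open>Principal ideals and cancellation\<close>

abbreviation principal :: "'a::comm_ring_1 \<Rightarrow> 'a ideal" where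
  "principal a \<equiv> gen {a}"

lemma elts_principal [simp]: "x \<in> elts (principal a) \<longleftrightarrow> a dvd x"
  by (auto simp: elts_gen ideal_generated_def module.span_singleton[OF module_times] dvd_def mult.commute)

lemma principal_mult_le_iff: "principal a * B \<le> C \<longleftrightarrow> (\<forall>b\<in>elts B. a * b \<in> elts C)"
  by (auto simp: ideal_mult_le_iff mult_in_elts mult.assoc elim!: dvdE)

lemma principal_mult: "principal a * principal b = principal (a * b)"
  by (rule ideal_eqI) (auto simp: principal_mult_le_iff mult_in_elts' simp flip: mult.assoc elim!: dvdE)

lemma ideal_le_principal:
  assumes "A \<le> principal a"
  obtains B where "A = principal a * B"
proof
  show "A = principal a * colon a A"
  proof (rule order.antisym)
    show "principal a * colon a A \<le> A"
      by (simp add: principal_mult_le_iff)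
    show "A \<le> principal a * colon a A"
      unfolding less_eq_ideal_def
    proof
      fix x assume x: "x \<in> elts A"
      then obtain k where k: "x = a * k"
        using elts_mono[OF assms] by auto
      with x show "x \<in> elts (principal a * colon a A)"
        by (simp add: elts_mult)
    qed
  qed
qed

text \<open>The multiples of \<open>a\<close> by elements of \<open>A\<close> are already closed
  under sums. In a domain, multiplication by a nonzero \<open>a\<close> is injective, which yields
  the cancellation laws below.\<close>

lemma elts_principal_mult: "elts (principal a * A) = (*) a ` elts A"
proof
  have id: "is_ideal ((*) a ` elts A)"
  proof (rule is_idealI)
    show "0 \<in> (*) a ` elts A"
      by (rule image_eqI[of _ _ 0]) simp_all
  qed (auto simp: image_iff mult.left_commute[of _ a] distrib_left[symmetric]
      intro: add_in_elts mult_in_elts)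
  have "principal a * A \<le> Ideal ((*) a ` elts A)"
    by (auto simp: principal_mult_le_iff elts_Ideal[OF id])
  then show "elts (principal a * A) \<subseteq> (*) a ` elts A"
    by (auto simp: less_eq_ideal_def elts_Ideal[OF id])
qed (auto intro: elts_mult)

lemma principal_mult_le_cancel:
  fixes a :: "'a::idom"
  assumes "a \<noteq> 0" "principal a * A \<le> principal a * B"
  shows "A \<le> B"
proof -
  have "inj ((*) a)"
    using assms(1) by (simp add: inj_on_def)
  then show ?thesis
    using assms(2) by (simp add: less_eq_ideal_def elts_principal_mult inj_image_subset_iff)
qed

lemma principal_mult_cancel:
  fixes a :: "'a::idom"
  assumes "a \<noteq> 0" "principal a * A = principal a * B"
  shows "A = B"
  using assms principal_mult_le_cancel by (metis order.antisym order.refl)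

section \<open>Ideals of a Dedekind domain\<close>

lemma wf_ideal_greater:
  assumes "noetherian TYPE('a::comm_ring_1)"
  shows "wf {(B, A :: 'a ideal). A < B}"
proof (rule ccontr)
  assume "\<not> ?thesis"
  then obtain f :: "nat \<Rightarrow> 'a ideal" where f: "f i < f (Suc i)" for i
    by (auto simp: wf_iff_no_infinite_down_chain)
  have mono: "f i \<le> f j" if "i \<le> j" for i j
    using that by (rule lift_Suc_mono_le[rotated]) (simp add: f less_imp_le)
  \<comment> \<open>The union of the chain is an ideal with finitely many generators; these all lie
    in one member, where the chain must stop growing.\<close>
  let ?U = "\<Union>i. elts (f i)"
  have "is_ideal ?U"
  proof (rule is_idealI)
    fix x y assume "x \<in> ?U" "y \<in> ?U"
    then obtain i j where "x \<in> elts (f i)" "y \<in> elts (f j)"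
      by auto
    then have "x \<in> elts (f (max i j))" "y \<in> elts (f (max i j))"
      using elts_mono[OF mono] by (meson max.cobounded1 max.cobounded2)+
    then have "x + y \<in> elts (f (max i j))"
      by (rule add_in_elts)
    then show "x + y \<in> ?U"
      by blast
  qed (auto intro: mult_in_elts)
  then obtain X where X: "finite X" "?U = elts (gen X)"
    using assms by (auto simp: noetherian_def elts_gen)
  have "\<exists>n. Y \<subseteq> elts (f n)" if "finite Y" "Y \<subseteq> ?U" for Y
    using that
  proof (induction Y)
    case (insert y Y)
    then obtain m n where "Y \<subseteq> elts (f m)" "y \<in> elts (f n)"
      by auto
    then have "insert y Y \<subseteq> elts (f (max m n))"
      using elts_mono[OF mono] by (meson insert_subset max.cobounded1 max.cobounded2 subset_iff)
    then show ?case ..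
  qed auto
  from this[OF X(1)] obtain n where "X \<subseteq> elts (f n)"
    using X(2) gen_base by blast
  then have "gen X \<le> f n"
    by simp
  then have "f (Suc n) \<le> f n"
    using X(2) by (auto simp: less_eq_ideal_def)
  with f[of n] show False
    by simp
qed

lemma ideal_induct [consumes 1, case_names greater]:
  assumes "noetherian TYPE('a::comm_ring_1)" and "\<And>A :: 'a ideal. (\<And>B. A < B \<Longrightarrow> P B) \<Longrightarrow> P A"
  shows "P A"
  using wf_ideal_greater[OF assms(1)] by (induction A rule: wf_induct_rule) (auto intro: assms(2))

section \<open>Maximal and prime ideals\<close>

lemma elts_eq_UNIV_iff: "elts A = UNIV \<longleftrightarrow> A = 1"
  by (metis elts_1 elts_inject)

lemma elts_eq_0_iff: "elts A = {0} \<longleftrightarrow> A = 0"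
  by (metis elts_0 elts_inject)

lemma maximal_ideal_elts_iff:
  "maximal_ideal (elts M) \<longleftrightarrow> M \<noteq> 1 \<and> (\<forall>J. M \<le> J \<longrightarrow> J = M \<or> J = 1)"
proof -
  have "(\<forall>J. is_ideal J \<and> elts M \<subseteq> J \<longrightarrow> J = elts M \<or> J = UNIV) \<longleftrightarrow>
      (\<forall>J. M \<le> J \<longrightarrow> J = M \<or> J = 1)"
    by (metis elts_1 elts_Ideal elts_inject is_ideal_elts less_eq_ideal_def)
  then show ?thesis
    by (simp add: maximal_ideal_def elts_eq_UNIV_iff)
qed

lemma prime_ideal_elts_iff:
  "prime_ideal (elts P) \<longleftrightarrow> P \<noteq> 1 \<and> (\<forall>x y. x * y \<in> elts P \<longrightarrow> x \<in> elts P \<or> y \<in> elts P)"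
  by (simp add: prime_ideal_def elts_eq_UNIV_iff)

lemma maximal_add_eq_1:
  assumes "maximal_ideal (elts M)" "\<not> A \<le> M"
  shows "M + A = 1"
  using assms ideal_le_add[of M A] ideal_le_add(2)[of A M] unfolding maximal_ideal_elts_iff by metis

lemma maximal_imp_prime:
  assumes "maximal_ideal (elts M)"
  shows "prime_ideal (elts M)"
  unfolding prime_ideal_elts_iff
proof (intro conjI allI impI)
  show "M \<noteq> 1"
    using assms by (simp add: maximal_ideal_elts_iff)
  fix x y assume xy: "x * y \<in> elts M"
  show "x \<in> elts M \<or> y \<in> elts M"
  proof (cases "x \<in> elts M")
    case False
    then have "1 \<in> elts (M + principal x)"
      using maximal_add_eq_1[OF assms, of "principal x"] by simp
    then obtain p r where "p \<in> elts M" "1 = p + x * r"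
      by (auto simp: elts_add elim!: dvdE)
    then have "y = p * y + x * y * r"
      by (metis distrib_right mult.assoc mult.commute mult_1)
    with xy \<open>p \<in> elts M\<close> show ?thesis
      by (metis add_in_elts mult_in_elts')
  qed simp
qed

text \<open>Noetherian induction takes the place of Zorn's lemma: a proper ideal that is not maximal
  lies strictly below another proper ideal.\<close>

lemma ex_maximal_ideal:
  assumes "noetherian TYPE('a::comm_ring_1)" and "A \<noteq> (1 :: 'a ideal)"
  shows "\<exists>M. maximal_ideal (elts M) \<and> A \<le> M"
  using assms
proof (induction A rule: ideal_induct)
  case (greater A)
  show ?case
  proof (cases "maximal_ideal (elts A)")
    case False
    then obtain J where "A < J" "J \<noteq> 1"
      using greater.prems by (auto simp: maximal_ideal_elts_iff order.strict_iff_order)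
    then show ?thesis
      using greater.IH by (meson less_imp_le order.trans)
  qed auto
qed

lemma prime_ideal_mult_le:
  assumes "prime_ideal (elts P)" "A * B \<le> P"
  shows "A \<le> P \<or> B \<le> P"
  using assms unfolding prime_ideal_elts_iff ideal_mult_le_iff unfolding less_eq_ideal_def by blast

lemma prime_ideal_prod_mset_le:
  assumes "prime_ideal (elts P)" "prod_mset M \<le> P"
  shows "\<exists>Q\<in>#M. Q \<le> P"
  using assms(2)
proof (induction M)
  case empty
  with assms(1) show ?case
    by (metis ideal_le_1 order.antisym prime_ideal_elts_iff prod_mset_empty)
next
  case (add Q M)
  then show ?case
    using prime_ideal_mult_le[OF assms(1), of Q "prod_mset M"] by auto
qed

text \<open>Noetherian induction: if \<open>x\<close> and \<open>y\<close> witness that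
  \<open>A\<close> is not prime, both \<open>A + principal x\<close> and
  \<open>A + principal y\<close> are strictly larger than \<open>A\<close>, while their product lies
  in \<open>A\<close>. The ideal \<open>1\<close> is handled by the empty product.\<close>

lemma ex_prime_product_le:
  assumes "noetherian TYPE('a::comm_ring_1)" and "A \<noteq> (0 :: 'a ideal)"
  shows "\<exists>M. (\<forall>P\<in>#M. prime_ideal (elts P) \<and> P \<noteq> 0) \<and> prod_mset M \<le> A"
  using assms
proof (induction A rule: ideal_induct)
  case (greater A)
  consider "A = 1" | "prime_ideal (elts A)"
    | x y where "x \<notin> elts A" "y \<notin> elts A" "x * y \<in> elts A"
    by (auto simp: prime_ideal_elts_iff)
  then show ?case
  proof cases
    case 1
    then show ?thesis
      by (intro exI[of _ "{#}"]) simp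
  next
    case 2
    then show ?thesis
      using greater.prems by (intro exI[of _ "{#A#}"]) simp
  next
    case 3
    have less: "A < A + principal z" if "z \<notin> elts A" for z
      using that ideal_add_le_iff[of A "principal z" A] by (auto simp: less_le_not_le)
    then have "A + principal z \<noteq> 0" if "z \<notin> elts A" for z
      using that by (metis ideal_ge_0 less_le_not_le)
    with less greater.IH obtain M N where
      M: "\<forall>P\<in>#M. prime_ideal (elts P) \<and> P \<noteq> 0" "prod_mset M \<le> A + principal x" and
      N: "\<forall>P\<in>#N. prime_ideal (elts P) \<and> P \<noteq> 0" "prod_mset N \<le> A + principal y"
      using 3 by meson
    have "prod_mset (M + N) \<le> (A + principal x) * (A + principal y)"
      using M(2) N(2) by (simp add: ideal_mult_mono)
    also have "\<dots> = A * (A + principal y) + (A * principal x + principal (x * y))"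
      by (simp only: distrib_right distrib_left[of "principal x"] principal_mult mult.commute[of "principal x" A])
    also have "\<dots> \<le> A"
      using 3 by (simp add: ideal_add_le_iff ideal_mult_le_left)
    finally show ?thesis
      using M N by (intro exI[of _ "M + N"]) auto
  qed
qed

section \<open>Integrality and inverses of maximal ideals\<close>

lemma elts_gen_lessThan:
  "x \<in> elts (gen (g ` {..<n::nat})) \<Longrightarrow> \<exists>r. x = (\<Sum>i<n. r i * g i)"
proof (induction n arbitrary: x)
  case 0
  then show ?case
    by (simp flip: zero_ideal_def)
next
  case (Suc n)
  have "x \<in> elts (gen (insert (g n) (g ` {..<n})))"
    using Suc.prems by (simp add: lessThan_Suc)
  then obtain k where "x - k * g n \<in> elts (gen (g ` {..<n}))"
    by (auto simp: elts_gen ideal_generated_def module.span_breakdown_eq[OF module_times])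
  then obtain r where "x - k * g n = (\<Sum>i<n. r i * g i)"
    using Suc.IH by blast
  then have "x = (\<Sum>i<Suc n. (r(n := k)) i * g i)"
    by (simp add: algebra_simps)
  then show ?case
    by (rule exI[of _ "r(n := k)"])
qed

lemma obtain_nonzero:
  assumes "A \<noteq> 0"
  obtains a where "a \<in> elts A" "a \<noteq> 0"
  using assms elts_eq_0_iff[of A] zero_in_elts[of A] by blast

text \<open>The fraction \<open>x = u / a\<close> maps \<open>A\<close> into itself, so the elements \<open>x ^ n * p\<close> with
  \<open>0 \<noteq> p \<in> A\<close> span a finitely generated ideal; a linear relation among them makes \<open>x\<close> integral.\<close>

lemma dvd_if_stabilizes:
  fixes a u :: "'a::idom"
  assumes "noetherian TYPE('a)" "integrally_closed TYPE('a)"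
    and "a \<noteq> 0" "A \<noteq> 0" and stab: "principal u * A \<le> principal a * A"
  shows "a dvd u"
proof -
  define x where "x = to_fract u / to_fract a"
  have step: "\<exists>j\<in>elts A. to_fract j = x * to_fract i" if "i \<in> elts A" for i
  proof -
    have "u * i \<in> elts (principal a * A)"
      using stab that by (simp add: principal_mult_le_iff)
    then obtain j where j: "j \<in> elts A" "u * i = a * j"
      unfolding elts_principal_mult by blast
    have "to_fract u * to_fract i = to_fract a * to_fract j"
      using j(2) by (metis to_fract_mult)
    then have "to_fract j = x * to_fract i"
      using \<open>a \<noteq> 0\<close> by (simp add: x_def field_simps)
    with j(1) show ?thesis ..
  qed
  obtain p where p: "p \<in> elts A" "p \<noteq> 0"
    using \<open>A \<noteq> 0\<close> by (rule obtain_nonzero)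
  have "\<exists>j\<in>elts A. to_fract j = x ^ n * to_fract p" for n
  proof (induction n)
    case (Suc n)
    then obtain i where i: "i \<in> elts A" "to_fract i = x ^ n * to_fract p"
      by blast
    then show ?case
      using step[OF i(1)] by (simp add: mult.assoc)
  qed (use p in auto)
  then obtain g where g: "to_fract (g n) = x ^ n * to_fract p" for n
    by metis
  define f where "f n = gen (g ` {..<n})" for n :: nat
  \<comment> \<open>The ideals \<open>f n\<close> ascend, so at some \<open>n\<close> two neighbours
    agree, and \<open>g n\<close> is a combination of its predecessors.\<close>
  obtain n where "\<not> f n < f (Suc n)"
    using wf_ideal_greater[OF assms(1)] by (auto simp: wf_iff_no_infinite_down_chain)
  moreover have "f n \<le> f (Suc n)"
    unfolding f_def by (auto intro: gen_base)
  ultimately have "f (Suc n) = f n"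
    by (auto simp: order.strict_iff_order)
  moreover have "g n \<in> elts (f (Suc n))"
    unfolding f_def by (auto intro: gen_base)
  ultimately obtain r where "g n = (\<Sum>i<n. r i * g i)"
    using elts_gen_lessThan unfolding f_def by metis
  then have "to_fract (g n) = (\<Sum>i<n. to_fract (r i) * to_fract (g i))"
    by simp
  then have "x ^ n * to_fract p = (\<Sum>i<n. to_fract (r i) * x ^ i) * to_fract p"
    by (simp add: g sum_distrib_right mult.assoc)
  then have rel: "x ^ n = (\<Sum>i<n. to_fract (r i) * x ^ i)"
    using p by simp
  \<comment> \<open>After division by \<open>to_fract p\<close>, the relation \<open>rel\<close>
    says that \<open>x\<close> is a root of the monic polynomial
    \<open>monom 1 n - q\<close>.\<close>
  define q where "q = (\<Sum>i<n. monom (r i) i)"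
  have coeff_q: "coeff q j = 0" if "j \<ge> n" for j
    using that by (auto simp: q_def coeff_sum intro!: sum.neutral)
  have deg: "degree (monom 1 n - q) = n"
  proof (rule order.antisym)
    show "degree (monom 1 n - q) \<le> n"
      by (rule degree_le) (simp add: coeff_q)
    show "n \<le> degree (monom 1 n - q)"
      by (rule le_degree) (simp add: coeff_q)
  qed
  have "lead_coeff (monom 1 n - q) = 1"
    unfolding deg by (simp add: coeff_q)
  moreover have "fract_poly q = (\<Sum>i<n. monom (to_fract (r i)) i)"
    using sum_comp_morphism[of "fract_poly :: 'a poly \<Rightarrow> _" "\<lambda>i. monom (r i) i" "{..<n}"]
    by (simp add: q_def map_poly_monom comp_def)
  then have "poly (fract_poly (monom 1 n - q)) x = 0"
    by (simp add: map_poly_monom poly_monom poly_sum rel)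
  ultimately have "x \<in> range to_fract"
    using assms(2) unfolding integrally_closed_def integral_over_base_def by blast
  then obtain z where "to_fract u / to_fract a = to_fract z"
    by (auto simp: x_def)
  then have "to_fract u = to_fract (z * a)"
    using \<open>a \<noteq> 0\<close> by (simp add: field_simps)
  then have "u = z * a"
    by (simp only: to_fract_eq_iff)
  then show ?thesis
    by simp
qed

lemma elts_ne_0: "a \<in> elts A \<Longrightarrow> a \<noteq> 0 \<Longrightarrow> A \<noteq> 0"
  by auto

lemma maximal_ideal_le_eq:
  assumes "maximal_ideal (elts P)" "maximal_ideal (elts Q)" "P \<le> Q"
  shows "P = Q"
  using assms by (auto simp: maximal_ideal_elts_iff)

text \<open>In terms of \<open>x = u / a\<close>: there is a fraction \<open>x \<notin> R\<close> with \<open>P * (R + x * R) = R\<close>.\<close>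

lemma maximal_ideal_invertible:
  fixes P :: "'a::idom ideal"
  assumes dedekind: "dedekind_domain TYPE('a)"
    and P: "maximal_ideal (elts P)" "P \<noteq> 0"
  obtains a u where "a \<noteq> 0" "\<not> a dvd u" "P * (principal a + principal u) = principal a"
proof -
  have noeth: "noetherian TYPE('a)" and closed: "integrally_closed TYPE('a)"
    and dim: "\<And>Q :: 'a ideal. prime_ideal (elts Q) \<Longrightarrow> Q \<noteq> 0 \<Longrightarrow> maximal_ideal (elts Q)"
    using dedekind elts_eq_0_iff by (auto simp: dedekind_domain_def)
  obtain a where a: "a \<in> elts P" "a \<noteq> 0"
    using P(2) by (rule obtain_nonzero)
  \<comment> \<open>Among the products of nonzero primes lying in \<open>principal a\<close>, one
    with fewest factors is taken. Dropping a factor then leaves an ideal that is not inside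
    \<open>principal a\<close>, which is where \<open>u\<close> comes from.\<close>
  define good where "good M \<longleftrightarrow>
    (\<forall>Q\<in>#M. prime_ideal (elts Q) \<and> Q \<noteq> 0) \<and> prod_mset M \<le> principal a" for M
  have "principal a \<noteq> 0"
    using a(2) by (intro elts_ne_0[of a]) simp_all
  then obtain M0 where "good M0"
    using ex_prime_product_le[OF noeth] unfolding good_def by blast
  then obtain M where M: "good M" and least: "\<And>N. good N \<Longrightarrow> size M \<le> size N"
    using ex_has_least_nat[of good M0 size] by blast
  \<comment> \<open>The prime \<open>P\<close> contains the product, hence one of its factors
    \<open>Q\<close>; nonzero primes are maximal here, so \<open>Q = P\<close>.\<close>
  have "prod_mset M \<le> P"
    using M a(1) unfolding good_def by (metis empty_subsetI gen_le_iff insert_subset order.trans)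
  then obtain Q where Q: "Q \<in># M" "Q \<le> P"
    using prime_ideal_prod_mset_le[OF maximal_imp_prime[OF P(1)]] by blast
  have "maximal_ideal (elts Q)"
    using M Q(1) by (intro dim) (simp_all add: good_def)
  then have "Q = P"
    using P(1) Q(2) by (rule maximal_ideal_le_eq)
  then obtain N where N: "M = add_mset P N"
    using Q(1) by (metis multi_member_split)
  have "\<not> prod_mset N \<le> principal a"
    using M least[of N] by (auto simp: good_def N)
  then obtain u where u: "u \<in> elts (prod_mset N)" "\<not> a dvd u"
    unfolding less_eq_ideal_def subset_eq elts_principal by blast
  have "P * principal u \<le> P * prod_mset N"
    using u(1) by (intro ideal_mult_mono) simp_all
  also have "\<dots> \<le> principal a"
    using M by (simp add: good_def N)
  finally have "P * (principal a + principal u) \<le> principal a"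
    by (simp only: distrib_left ideal_add_le_iff mult.commute[of P "principal a"] ideal_mult_le_left)
  then obtain E where E: "P * (principal a + principal u) = principal a * E"
    by (rule ideal_le_principal)
  \<comment> \<open>Since \<open>P <= E\<close>, the ideal \<open>E\<close> is \<open>P\<close> or
    \<open>1\<close>. If it were \<open>P\<close>, multiplication by \<open>u / a\<close> would map
    \<open>P\<close> into itself, and integral closedness would give \<open>a dvd u\<close>.\<close>
  have "principal a * P \<le> principal a * E"
    unfolding E[symmetric] by (simp only: distrib_left mult.commute[of P "principal a"] ideal_le_add)
  then have "P \<le> E"
    using principal_mult_le_cancel[OF a(2)] by blast
  moreover have "E \<noteq> P"
  proof
    assume "E = P"
    have "principal u * P \<le> P * (principal a + principal u)"
      by (simp only: distrib_left mult.commute[of P "principal u"] ideal_le_add)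
    then have "principal u * P \<le> principal a * P"
      using E \<open>E = P\<close> by simp
    with dvd_if_stabilizes[OF noeth closed a(2) P(2)] u(2) show False
      by blast
  qed
  ultimately have "E = 1"
    using P(1) by (auto simp: maximal_ideal_elts_iff)
  with a(2) u(2) E that show ?thesis
    by simp
qed

section \<open>Factorization and invertibility of nonzero ideals\<close>

lemma principal_1: "principal 1 = 1"
  by (simp add: ideal_eq_1_iff)

text \<open>Noetherian induction: a proper \<open>A\<close> lies in a maximal \<open>P\<close>, and
  dividing by \<open>P\<close> gives a strictly larger ideal \<open>I\<close>. The factors of
  \<open>I\<close> together with \<open>P\<close> factor \<open>A\<close>. The same recursion
  multiplies the inverses, with \<open>B\<close> over \<open>t\<close> standing for the inverse
  fractional ideal.\<close>

lemma ideal_factorization_aux: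
  fixes A :: "'a::idom ideal"
  assumes dedekind: "dedekind_domain TYPE('a)" and "A \<noteq> 0"
  shows "\<exists>M B t. (\<forall>P\<in>#M. maximal_ideal (elts P)) \<and> prod_mset M = A \<and> t \<noteq> 0 \<and> A * B = principal t"
proof -
  have noeth: "noetherian TYPE('a)" and closed: "integrally_closed TYPE('a)"
    using dedekind by (auto simp: dedekind_domain_def)
  show ?thesis
    using noeth \<open>A \<noteq> 0\<close>
  proof (induction A rule: ideal_induct)
    case (greater A)
    show ?case
    proof (cases "A = 1")
      case True
      then show ?thesis
        by (intro exI[of _ "{#}"] exI[of _ "1 :: 'a ideal"] exI[of _ "1 :: 'a"])
          (simp add: principal_1)
    next
      case False
      then obtain P where P: "maximal_ideal (elts P)" "A \<le> P"
        using ex_maximal_ideal[OF noeth] by blast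
      have "P \<noteq> 0"
        using P(2) greater.prems ideal_ge_0[of A] by (auto intro: order.antisym)
      then obtain a u where au: "a \<noteq> 0" "\<not> a dvd u" "P * (principal a + principal u) = principal a"
        by (rule maximal_ideal_invertible[OF dedekind P(1)])
      \<comment> \<open>\<open>V\<close> is \<open>a\<close> times the inverse of \<open>P\<close>,
        so the \<open>I\<close> obtained below is \<open>A\<close> times that inverse.\<close>
      define V where "V = principal a + principal u"
      have PV: "P * V = principal a"
        using au(3) by (simp add: V_def)
      have "A * V \<le> P * V"
        using P(2) by (intro ideal_mult_mono) simp_all
      then obtain I where I: "A * V = principal a * I"
        unfolding PV by (rule ideal_le_principal)
      have "principal a * A = P * (A * V)"
        by (simp only: PV[symmetric] mult_ac)
      also have "\<dots> = principal a * (P * I)"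
        by (simp only: I mult.left_commute)
      finally have A: "A = P * I"
        using principal_mult_cancel[OF au(1)] by blast
      \<comment> \<open>The generator \<open>a\<close> of \<open>V\<close> gives
        \<open>A <= I\<close>. The generator \<open>u\<close> makes the inclusion strict: with
        \<open>A = I\<close>, the fraction \<open>u / a\<close> would stabilize
        \<open>A\<close>.\<close>
      have "principal a * A \<le> A * V" "principal u * A \<le> A * V"
        by (simp_all only: V_def distrib_left mult.commute[of A] ideal_le_add)
      then have le: "principal a * A \<le> principal a * I" "principal u * A \<le> principal a * I"
        using I by simp_all
      have "A \<le> I"
        using le(1) principal_mult_le_cancel[OF au(1)] by blast
      moreover have "A \<noteq> I"
      proof
        assume "A = I"
        with le(2) have "principal u * A \<le> principal a * A"
          by simp
        from dvd_if_stabilizes[OF noeth closed au(1) greater.prems this] au(2) show False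
          by contradiction
      qed
      ultimately have "A < I"
        by simp
      moreover have "I \<noteq> 0"
        using greater.prems A by auto
      ultimately obtain M B t where *: "\<forall>P\<in>#M. maximal_ideal (elts P)" "prod_mset M = I"
          "t \<noteq> 0" "I * B = principal t"
        using greater.IH[of I] by metis
      have "A * (V * B) = (P * V) * (I * B)"
        by (simp only: A mult_ac)
      also have "\<dots> = principal (a * t)"
        by (simp only: PV *(4) principal_mult)
      finally have "A * (V * B) = principal (a * t)" .
      moreover have "prod_mset (add_mset P M) = A"
        by (simp add: A *(2))
      moreover have "\<forall>Q\<in>#add_mset P M. maximal_ideal (elts Q)"
        using *(1) P(1) by simp
      moreover have "a * t \<noteq> 0"
        using au(1) *(3) by simp
      ultimately show ?thesis
        by (intro exI conjI)
    qed
  qed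
qed

lemma ideal_factorization:
  fixes A :: "'a::idom ideal"
  assumes "dedekind_domain TYPE('a)" and "A \<noteq> 0"
  obtains M where "\<forall>P\<in>#M. maximal_ideal (elts P)" "prod_mset M = A"
  using ideal_factorization_aux[OF assms] by blast

lemma ideal_invertible:
  fixes A :: "'a::idom ideal"
  assumes "dedekind_domain TYPE('a)" and "A \<noteq> 0"
  obtains B t where "t \<noteq> 0" "A * B = principal t"
  using ideal_factorization_aux[OF assms] by blast

text \<open>The cofactor is \<open>B\<close> times the inverse of \<open>A\<close>; it consists of
  ring elements because \<open>B * A'\<close> lies in \<open>A * A' = principal t\<close>.\<close>

lemma ideal_le_imp_dvd:
  fixes A B :: "'a::idom ideal"
  assumes "dedekind_domain TYPE('a)" "A \<noteq> 0" "B \<le> A"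
  shows "A dvd B"
proof -
  obtain A' t where t: "t \<noteq> 0" "A * A' = principal t"
    by (rule ideal_invertible[OF assms(1,2)])
  have "B * A' \<le> A * A'"
    using assms(3) by (intro ideal_mult_mono) simp_all
  then obtain E where E: "B * A' = principal t * E"
    unfolding t(2) by (rule ideal_le_principal)
  have "principal t * B = A * (B * A')"
    by (simp only: t(2)[symmetric] mult_ac)
  also have "\<dots> = principal t * (A * E)"
    by (simp only: E mult.left_commute)
  finally have "B = A * E"
    using principal_mult_cancel[OF t(1)] by blast
  then show ?thesis
    by simp
qed

lemma ideal_mult_eq_self:
  fixes A P :: "'a::idom ideal"
  assumes "dedekind_domain TYPE('a)" "A \<noteq> 0" "P * A = A"
  shows "P = 1"
proof -
  obtain A' t where t: "t \<noteq> 0" "A * A' = principal t"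
    by (rule ideal_invertible[OF assms(1,2)])
  have "principal t * P = (P * A) * A'"
    by (simp only: t(2)[symmetric] mult_ac)
  also have "\<dots> = principal t * 1"
    by (simp add: assms(3) t(2))
  finally show ?thesis
    using principal_mult_cancel[OF t(1)] by blast
qed

section \<open>Comaximal ideals\<close>

text \<open>In the expansion of \<open>(A + B) * (A + C)\<close>, every term except
  \<open>B * C\<close> lies in \<open>A\<close>.\<close>

lemma comaximal_mult:
  fixes A B C :: "'a::comm_ring_1 ideal"
  assumes "A + B = 1" "A + C = 1"
  shows "A + B * C = 1"
proof (rule order.antisym)
  have "1 = (A + B) * (A + C)"
    using assms by simp
  also have "\<dots> = A * (A + C) + (A * B + B * C)"
    by (simp only: distrib_right distrib_left[of B] mult.commute[of B A])
  also have "\<dots> \<le> A + B * C"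
    by (simp add: ideal_add_le_iff order.trans[OF ideal_mult_le_left])
  finally show "1 \<le> A + B * C" .
qed simp

lemma comaximal_1 [simp]: "A + 1 = (1 :: 'a::comm_ring_1 ideal)"
  by (simp add: ideal_add_absorb)

lemma comaximal_prod:
  fixes A :: "'a::comm_ring_1 ideal"
  assumes "\<And>i. i \<in> F \<Longrightarrow> A + f i = 1"
  shows "A + prod f F = 1"
  using assms by (induction F rule: infinite_finite_induct) (simp_all add: comaximal_mult)

lemma comaximal_power:
  fixes A B :: "'a::comm_ring_1 ideal"
  assumes "A + B = 1"
  shows "A ^ m + B ^ n = 1"
proof -
  have pow: "A + B ^ n = 1" if "A + B = 1" for A B :: "'a ideal" and n
    using that comaximal_prod[of "{..<n}" A "\<lambda>_. B"] by simp
  have "B ^ n + A = 1"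
    using pow[OF assms] by (simp add: add.commute)
  then show ?thesis
    using pow by (metis add.commute)
qed

text \<open>Write \<open>1 = a + b\<close> with \<open>a\<close> in \<open>A\<close> and
  \<open>b\<close> in \<open>B\<close>; both terms of \<open>x = a * x + x * b\<close> lie in the
  product.\<close>

lemma comaximal_Int_le_mult:
  fixes A B :: "'a::comm_ring_1 ideal"
  assumes "A + B = 1" "x \<in> elts A" "x \<in> elts B"
  shows "x \<in> elts (A * B)"
proof -
  have "1 \<in> elts (A + B)"
    using assms(1) by simp
  then obtain a b where ab: "a \<in> elts A" "b \<in> elts B" "1 = a + b"
    by (auto simp: elts_add)
  have "x = a * x + x * b"
    using ab(3) by (metis distrib_left mult.commute mult_1_right)
  then show ?thesis
    using ab assms by (metis add_in_elts elts_mult)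
qed

lemma comaximal_Inter_le_prod:
  fixes f :: "'i \<Rightarrow> 'a::comm_ring_1 ideal"
  assumes "finite F" "\<And>i j. i \<in> F \<Longrightarrow> j \<in> F \<Longrightarrow> i \<noteq> j \<Longrightarrow> f i + f j = 1"
    and "\<And>i. i \<in> F \<Longrightarrow> x \<in> elts (f i)"
  shows "x \<in> elts (prod f F)"
  using assms
proof (induction F)
  case (insert k F)
  have "f k + prod f F = 1"
    using insert by (intro comaximal_prod) auto
  with insert show ?case
    by (simp add: comaximal_Int_le_mult)
qed simp

lemma prod_le_factor:
  fixes f :: "'i \<Rightarrow> 'a::comm_ring_1 ideal"
  assumes "finite F" "i \<in> F"
  shows "prod f F \<le> f i"
  by (simp add: prod.remove[OF assms] ideal_mult_le_left)

text \<open>Induction on \<open>F\<close>: with \<open>1 = p + q\<close>, \<open>p\<close> in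
  \<open>f k\<close> and \<open>q\<close> in the product of the other ideals, the element
  \<open>b * p + s k * q\<close> is congruent to \<open>s k\<close> modulo \<open>f k\<close> and to
  the old solution \<open>b\<close> modulo the others.\<close>

lemma ideal_chinese_remainder:
  fixes f :: "'i \<Rightarrow> 'a::comm_ring_1 ideal"
  assumes "finite F" "\<And>i j. i \<in> F \<Longrightarrow> j \<in> F \<Longrightarrow> i \<noteq> j \<Longrightarrow> f i + f j = 1"
  shows "\<exists>b. \<forall>i\<in>F. b - s i \<in> elts (f i)"
  using assms
proof (induction F)
  case (insert k F)
  then obtain b where b: "b - s i \<in> elts (f i)" if "i \<in> F" for i
    by auto
  have "f k + prod f F = 1"
    using insert by (intro comaximal_prod) auto
  then have "1 \<in> elts (f k + prod f F)"
    by simp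
  then obtain p q where pq: "p \<in> elts (f k)" "q \<in> elts (prod f F)" "1 = p + q"
    by (auto simp: elts_add)
  have q: "q = 1 - p"
    using pq(3) by (simp add: eq_diff_eq add.commute)
  define c where "c = b * p + s k * q"
  have "c - s k = (b - s k) * p"
    by (simp add: c_def q algebra_simps)
  then have "c - s k \<in> elts (f k)"
    using pq(1) by (simp add: mult_in_elts)
  moreover have "c - s i \<in> elts (f i)" if "i \<in> F" for i
  proof -
    have "c - s i = (b - s i) + (s k - b) * q"
      by (simp add: c_def q algebra_simps)
    moreover have "q \<in> elts (f i)"
      using prod_le_factor[OF insert.hyps(1) that] pq(2) by (rule elts_mono)
    then have "(b - s i) + (s k - b) * q \<in> elts (f i)"
      by (intro add_in_elts mult_in_elts b that)
    ultimately show ?thesis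
      by (simp only:)
  qed
  ultimately show ?case
    by auto
qed simp

section \<open>Fixed divisors\<close>

lemma mult_diff_in_elts:
  assumes "a - a' \<in> elts A" "b - b' \<in> elts A"
  shows "a * b - a' * b' \<in> elts A"
proof -
  have "a * b - a' * b' = (a - a') * b + a' * (b - b')"
    by (simp add: algebra_simps)
  then show ?thesis
    using assms by (simp add: add_in_elts mult_in_elts mult_in_elts')
qed

lemma prod_diff_in_elts:
  assumes "\<And>i. i \<in> F \<Longrightarrow> g i - h i \<in> elts A"
  shows "prod g F - prod h F \<in> elts A"
  using assms by (induction F rule: infinite_finite_induct) (simp_all add: mult_diff_in_elts)

text \<open>Congruence modulo \<open>A\<close> passes through products, hence through powers and
  monomials, and then through sums with fixed coefficients.\<close>

lemma mpol_eval_diff_in_elts: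
  assumes "\<And>i. x $ i - y $ i \<in> elts A"
  shows "mpol_eval f x - mpol_eval f y \<in> elts A"
proof -
  have pow: "(x $ i) ^ n - (y $ i) ^ n \<in> elts A" for i n
    using prod_diff_in_elts[of "{..<n}" "\<lambda>_. x $ i" "\<lambda>_. y $ i" A] assms by simp
  show ?thesis
    unfolding mpol_eval_def sum_subtractf[symmetric] right_diff_distrib[symmetric]
    by (intro sum_in_elts mult_in_elts prod_diff_in_elts pow)
qed

theorem theorem5p4:
  fixes S :: "('a::idom ^ 'n::finite) set"
    and f :: "('n, 'a) mpol"
    and m :: "nat ^ 'n" and k :: nat
    and a :: "'a ^ 'n"
  assumes "dedekind_domain TYPE('a)"
    and "vanishing_ideal S = {0}"
    and "has_type f m k"
    and "a \<in> S" and "mpol_eval f a \<noteq> 0"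
  shows "\<exists>b :: 'a ^ 'n. fixed_divisor S f = ideal_generated {mpol_eval f a, mpol_eval f b}"
proof -
  note dedekind = assms(1)
  define D where "D = gen (mpol_eval f ` S)"
  define c where "c = mpol_eval f a"
  have in_D: "mpol_eval f s \<in> elts D" if "s \<in> S" for s
    unfolding D_def using that by (intro gen_base) simp
  have c: "c \<in> elts D" "c \<noteq> 0"
    using in_D assms(4,5) by (simp_all add: c_def)
  then have "D \<noteq> 0" "principal c \<noteq> 0"
    using elts_ne_0[of c D] elts_ne_0[of c "principal c"] by simp_all
  obtain N where N: "\<forall>P\<in>#N. maximal_ideal (elts P)" "prod_mset N = principal c"
    by (rule ideal_factorization[OF dedekind \<open>principal c \<noteq> 0\<close>])
  obtain M where M: "\<forall>P\<in>#M. maximal_ideal (elts P)" "prod_mset M = D"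
    by (rule ideal_factorization[OF dedekind \<open>D \<noteq> 0\<close>])
  \<comment> \<open>\<open>F\<close> is the set of maximal ideals containing \<open>c\<close>. Since
    \<open>c\<close> lies in \<open>D\<close>, it includes every factor of \<open>D\<close>; members
    of \<open>F\<close> that do not divide \<open>D\<close> get the exponent
    \<open>d P = 0\<close>.\<close>
  define F where "F = set_mset N"
  define d where "d P = count M P" for P
  have [simp]: "finite F"
    by (simp add: F_def)
  have in_F: "P \<in> F" if P: "maximal_ideal (elts P)" "c \<in> elts P" for P
  proof -
    have "prod_mset N \<le> P"
      using P(2) N(2) by simp
    then obtain Q where "Q \<in># N" "Q \<le> P"
      using prime_ideal_prod_mset_le[OF maximal_imp_prime[OF P(1)]] by blast
    then show ?thesis
      using maximal_ideal_le_eq[OF N(1)[rule_format] P(1)] by (auto simp: F_def)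
  qed
  have factor_le: "prod_mset L \<le> P" if "P \<in># L" for P :: "'a ideal" and L
    using that ideal_mult_le_left by (auto dest!: multi_member_split)
  have "P \<in> F" if "P \<in># M" for P
    using in_F[OF M(1)[rule_format, OF that]] elts_mono[OF factor_le[OF that]] M(2) c(1) by simp
  then have "set_mset M \<subseteq> F"
    by blast
  then have D: "D = (\<Prod>P\<in>F. P ^ d P)"
    unfolding M(2)[symmetric] prod_mset_multiplicity d_def
    by (intro prod.mono_neutral_left) (auto simp: not_in_iff)
  have comax: "P ^ i + Q ^ j = 1" if "P \<in> F" "Q \<in> F" "P \<noteq> Q" for P Q i j
  proof (intro comaximal_power maximal_add_eq_1)
    have max: "maximal_ideal (elts P)" "maximal_ideal (elts Q)"
      using that N(1) by (simp_all add: F_def)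
    then show "maximal_ideal (elts P)"
      by simp
    show "\<not> Q \<le> P"
      using maximal_ideal_le_eq[OF max(2,1)] that(3) by blast
  qed
  \<comment> \<open>Otherwise \<open>P * D\<close> would contain all generators of \<open>D\<close>,
    so \<open>P * D = D\<close>, and cancelling \<open>D\<close> would give
    \<open>P = 1\<close>.\<close>
  have "\<exists>s\<in>S. mpol_eval f s \<notin> elts (P * D)" if "P \<in> F" for P
  proof (rule ccontr)
    assume "\<not> ?thesis"
    then have "D \<le> P * D"
      by (auto simp: D_def)
    then have "P * D = D"
      using ideal_mult_le_left[of D P] by (simp add: mult.commute order.antisym)
    then show False
      using ideal_mult_eq_self[OF dedekind \<open>D \<noteq> 0\<close>] N(1) that
      by (auto simp: F_def maximal_ideal_elts_iff)
  qed
  then obtain s where s: "\<And>P. P \<in> F \<Longrightarrow> s P \<in> S"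
      "\<And>P. P \<in> F \<Longrightarrow> mpol_eval f (s P) \<notin> elts (P * D)"
    by metis
  \<comment> \<open>The point is built coordinate by coordinate. The exponent is one above
    \<open>d P\<close> because, for elements of \<open>D\<close>, membership in
    \<open>P ^ Suc (d P)\<close> decides membership in \<open>P * D\<close>.\<close>
  have "\<exists>y. \<forall>P\<in>F. y - s P $ i \<in> elts (P ^ Suc (d P))" for i
    by (rule ideal_chinese_remainder[OF \<open>finite F\<close> comax])
  then obtain y where y: "\<And>i P. P \<in> F \<Longrightarrow> y i - s P $ i \<in> elts (P ^ Suc (d P))"
    by metis
  define b where "b = (\<chi> i. y i)"
  have b: "mpol_eval f b - mpol_eval f (s P) \<in> elts (P ^ Suc (d P))" if "P \<in> F" for P
    using y[OF that] by (intro mpol_eval_diff_in_elts) (simp add: b_def)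
  \<comment> \<open>Powers of distinct members of \<open>F\<close> are comaximal, so each
    \<open>P ^ d P\<close> can be treated alone; there the value at \<open>b\<close> is congruent to
    the value at \<open>s P\<close>, which lies in \<open>D\<close>.\<close>
  have "mpol_eval f b \<in> elts D"
    unfolding D
  proof (rule comaximal_Inter_le_prod)
    fix P assume P: "P \<in> F"
    have "D \<le> P ^ d P"
      unfolding D using P by (intro prod_le_factor) simp_all
    then have "mpol_eval f (s P) \<in> elts (P ^ d P)"
      using in_D[OF s(1)[OF P]] by (rule elts_mono)
    moreover have "P ^ Suc (d P) \<le> P ^ d P"
      unfolding power_Suc2 by (rule ideal_mult_le_left)
    then have "mpol_eval f b - mpol_eval f (s P) \<in> elts (P ^ d P)"
      using b[OF P] by (rule elts_mono)
    ultimately have "mpol_eval f (s P) + (mpol_eval f b - mpol_eval f (s P)) \<in> elts (P ^ d P)"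
      by (rule add_in_elts)
    then show "mpol_eval f b \<in> elts (P ^ d P)"
      by simp
  qed (auto intro: comax)
  define J where "J = gen {c, mpol_eval f b}"
  have "J \<le> D"
    using \<open>mpol_eval f b \<in> elts D\<close> c(1) by (simp add: J_def)
  then obtain E where E: "J = D * E"
    using ideal_le_imp_dvd[OF dedekind \<open>D \<noteq> 0\<close>] by (auto elim: dvdE)
  have "E = 1"
  proof (rule ccontr)
    assume "E \<noteq> 1"
    then obtain P where P: "maximal_ideal (elts P)" "E \<le> P"
      using ex_maximal_ideal dedekind unfolding dedekind_domain_def by blast
    have "J \<le> D * P"
      unfolding E using P(2) by (intro ideal_mult_mono) simp_all
    then have c_in: "c \<in> elts (D * P)" and fb_in: "mpol_eval f b \<in> elts (D * P)"
      by (simp_all add: J_def)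
    \<comment> \<open>From \<open>J <= D * P\<close> follows that \<open>c\<close> lies in
      \<open>P\<close>, so \<open>P\<close> is one of the ideals for which \<open>b\<close> was
      adjusted.\<close>
    have "P \<in> F"
      using in_F[OF P(1)] elts_mono[OF ideal_mult_le_left[of P D]] c_in
      by (simp add: mult.commute)
    \<comment> \<open>\<open>R\<close> is the part of \<open>D\<close> prime to \<open>P\<close>.
      The value at \<open>s P\<close> lies in \<open>R\<close> because it lies in \<open>D\<close>,
      and in \<open>P ^ Suc (d P)\<close> because the value at \<open>b\<close> does; comaximality
      then places it in \<open>P * D\<close>, against the choice of \<open>s P\<close>.\<close>
    define R where "R = (\<Prod>Q\<in>F - {P}. Q ^ d Q)"
    have DR: "D = P ^ d P * R"
      unfolding D R_def by (rule prod.remove) (use \<open>P \<in> F\<close> in simp_all)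
    have DP: "P ^ Suc (d P) * R = P * D"
      by (simp only: DR power_Suc mult.assoc)
    have "D * P \<le> P ^ Suc (d P)"
      using ideal_mult_le_left[of "P ^ Suc (d P)" R] by (simp only: DP mult.commute[of D P])
    then have "mpol_eval f b \<in> elts (P ^ Suc (d P))"
      using fb_in by (rule elts_mono)
    from diff_in_elts[OF this b[OF \<open>P \<in> F\<close>]]
    have "mpol_eval f (s P) \<in> elts (P ^ Suc (d P))"
      by simp
    moreover have "D \<le> R"
      using ideal_mult_le_left[of R "P ^ d P"] by (simp only: DR mult.commute)
    then have "mpol_eval f (s P) \<in> elts R"
      using in_D[OF s(1)[OF \<open>P \<in> F\<close>]] by (rule elts_mono)
    moreover have "P ^ Suc (d P) + R = 1"
      unfolding R_def using \<open>P \<in> F\<close> by (intro comaximal_prod comax) auto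
    ultimately have "mpol_eval f (s P) \<in> elts (P ^ Suc (d P) * R)"
      by (intro comaximal_Int_le_mult)
    then show False
      using s(2)[OF \<open>P \<in> F\<close>] by (simp only: DP)
  qed
  then have "elts D = elts J"
    by (simp add: E)
  then show ?thesis
    by (intro exI[of _ b]) (simp add: D_def J_def c_def elts_gen fixed_divisor_def)
qed

end
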